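(* Let $d\ge3$, let $t\in\{5,7\}$, and let $X\subset S^{d-1}$ be a tight spherical $t$-design. Let $\{\langle x,y\rangle\mid x,y\in X,\ x\neq y\}=\{\alpha_1,\dots,\alpha_s\}$ (distinct values), $\alpha_0=1$, and $R_k=\{(x,y)\in X\times X\mid\langle x,y\rangle=\alpha_k\}$ for $0\le k\le s$. Then $(X,\{R_k\}_{k=0}^s)$ is a triply regular association scheme.
   Context: $S^{d-1}$ is the unit sphere in $\mathbb{R}^d$. A finite non-empty $X\subset S^{d-1}$ is a spherical $t$-design if the average over $X$ of every real polynomial of degree at most $t$ equals its average over $S^{d-1}$ (uniform measure). A spherical $t$-design with $t$ odd satisfies $|X|\ge2\binom{d+(t-3)/2}{(t-1)/2}$; it is called tight if equality holds. Symmetric association scheme: a finite set $X$ with a partition $\{R_k\}_{k=0}^s$ of $X\times X$ into symmetric relations, $R_0$ being the diagonal, such that for all $i,j,k$ the number $|\{w\in X\mid(x,w)\in R_i,(w,y)\in R_j\}|$ is independent of the choice of $(x,y)\in R_k$. A symmetric association scheme is triply regular if for all $i,j,k,l,m,n\in\{0,\dots,s\}$ and all $x,y,z\in X$ with $(x,y)\in R_i$, $(y,z)\in R_j$, $(z,x)\in R_k$, the number $|\{w\in X\mid(w,x)\in R_m,(w,y)\in R_n,(w,z)\in R_l\}|$ depends only on $i,j,k,l,m,n$ and not on $x,y,z$. *)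

theory Defs
  imports "HOL-Analysis.Analysis"
begin

definition monomial_fun :: "('n::finite \<Rightarrow> nat) \<Rightarrow> real ^ 'n \<Rightarrow> real" where
  "monomial_fun e x = (\<Prod>i\<in>UNIV. (x $ i) ^ e i)"

definition polynomial_fun_le :: "nat \<Rightarrow> (real ^ 'n::finite \<Rightarrow> real) \<Rightarrow> bool" where
  "polynomial_fun_le t f \<longleftrightarrow>
     (\<exists>c. f = (\<lambda>x. \<Sum>e | (\<Sum>i\<in>UNIV. e i) \<le> t. c e * monomial_fun e x))"

text \<open>
  The radial projection of the uniform distribution on the unit ball is invariant under
  orthogonal maps, hence it is the normalised surface measure of the sphere.
\<close>
definition uniform_sphere :: "(real ^ 'n::finite) measure" where
  "uniform_sphere = distr (uniform_measure lborel (ball 0 1)) borel (\<lambda>x. x /\<^sub>R norm x)"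

definition spherical_design :: "nat \<Rightarrow> (real ^ 'n::finite) set \<Rightarrow> bool" where
  "spherical_design t X \<longleftrightarrow>
     finite X \<and> X \<noteq> {} \<and> X \<subseteq> sphere 0 1 \<and>
     (\<forall>f. polynomial_fun_le t f \<longrightarrow>
        (\<Sum>x\<in>X. f x) / real (card X) = (\<integral>x. f x \<partial>uniform_sphere))"

text \<open>
  Tightness is only defined for odd \<open>t\<close>; the truncated divisions and subtractions are
  then exact for \<open>t \<ge> 3\<close>.
\<close>
definition tight_spherical_design :: "nat \<Rightarrow> (real ^ 'n::finite) set \<Rightarrow> bool" where
  "tight_spherical_design t X \<longleftrightarrow>
     odd t \<and> spherical_design t X \<and>
     card X = 2 * ((CARD('n) + (t - 3) div 2) choose ((t - 1) div 2))"

definition symmetric_association_scheme ::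
    "'a set \<Rightarrow> nat \<Rightarrow> (nat \<Rightarrow> ('a \<times> 'a) set) \<Rightarrow> bool" where
  "symmetric_association_scheme X s R \<longleftrightarrow>
     finite X \<and>
     (\<Union>k\<le>s. R k) = X \<times> X \<and> disjoint_family_on R {..s} \<and> (\<forall>k\<le>s. R k \<noteq> {}) \<and>
     (\<forall>k\<le>s. sym (R k)) \<and>
     R 0 = Id_on X \<and>
     (\<forall>i\<le>s. \<forall>j\<le>s. \<forall>k\<le>s. \<exists>p. \<forall>x y. (x, y) \<in> R k \<longrightarrow>
        card {w \<in> X. (x, w) \<in> R i \<and> (w, y) \<in> R j} = p)"

definition triply_regular_association_scheme ::
    "'a set \<Rightarrow> nat \<Rightarrow> (nat \<Rightarrow> ('a \<times> 'a) set) \<Rightarrow> bool" where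
  "triply_regular_association_scheme X s R \<longleftrightarrow>
     symmetric_association_scheme X s R \<and>
     (\<forall>i\<le>s. \<forall>j\<le>s. \<forall>k\<le>s. \<forall>l\<le>s. \<forall>m\<le>s. \<forall>n\<le>s. \<exists>p. \<forall>x\<in>X. \<forall>y\<in>X. \<forall>z\<in>X.
        (x, y) \<in> R i \<longrightarrow> (y, z) \<in> R j \<longrightarrow> (z, x) \<in> R k \<longrightarrow>
        card {w \<in> X. (w, x) \<in> R m \<and> (w, y) \<in> R n \<and> (w, z) \<in> R l} = p)"

end

theory Submission imports Defs begin

text \<open>
  Two triples of points of \<open>X\<close> with the same inner products are related by an orthogonal
  map \<open>T\<close>. The uniform measure is invariant under \<open>T\<close>, so for a polynomial \<open>f\<close> of degree at most
  \<open>t\<close> the design property gives \<open>\<Sum>x\<in>X. f (T x) = \<Sum>x\<in>X. f x\<close>, although \<open>T\<close> need not map \<open>X\<close> to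
  itself. Counting the points of \<open>X\<close> that have prescribed inner products with a triple is therefore
  independent of the triple as soon as the count is a sum over \<open>X\<close> of such a polynomial.

  Tightness makes this possible. With \<open>e = (t - 1) / 2\<close>, the equality case of the linear programming
  bound for the polynomial \<open>(1 + u) * g(u)\<^sup>2\<close>, where \<open>g\<close> has degree \<open>e\<close>, shows that \<open>X\<close> is
  antipodal and that every inner product other than \<open>1\<close> and \<open>-1\<close> is a root of \<open>g\<close>, hence lies in a
  set \<open>B\<close> of at most \<open>e\<close> numbers. Here \<open>g(u) = u\<^sup>2 - 1 / (d + 2)\<close> for \<open>t = 5\<close> and
  \<open>g(u) = u * (u\<^sup>2 - 3 / (d + 4))\<close> for \<open>t = 7\<close>.

  The points \<open>w\<close> for which some inner product with the triple \<open>x, y, z\<close> is \<open>1\<close> or \<open>-1\<close> are exactly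
  those of \<open>{x, -x, y, -y, z, -z}\<close>, a set that \<open>T\<close> carries to its analogue. For the other \<open>w\<close>, the
  indicator function of prescribed inner products is a product of three Lagrange basis polynomials
  on \<open>B\<close>, of degree at most \<open>3 * (e - 1)\<close>, which is at most \<open>t = 2 * e + 1\<close> because \<open>e \<le> 4\<close>. This is
  \<open>joint_inner_product_count_cong\<close>. The intersection numbers of the scheme are the triple
  intersection numbers for a triple \<open>x, y, x\<close>.
\<close>

section \<open>Orthogonal invariance of the uniform measure on the sphere\<close>

lemma nn_integral_lborel_translate:
  fixes f :: "'a::euclidean_space \<Rightarrow> ennreal"
  assumes [measurable]: "f \<in> borel_measurable borel"
  shows "(\<integral>\<^sup>+x. f (a + x) \<partial>lborel) = (\<integral>\<^sup>+x. f x \<partial>lborel)"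
  by (subst (2) lborel_distr_plus[of a, symmetric]) (simp add: nn_integral_distr)

lemma nn_integral_lborel_reflect:
  fixes f :: "'a::euclidean_space \<Rightarrow> ennreal"
  assumes [measurable]: "f \<in> borel_measurable borel"
  shows "(\<integral>\<^sup>+x. f (a - x) \<partial>lborel) = (\<integral>\<^sup>+x. f x \<partial>lborel)"
  by (subst (2) lborel_affine[of "-1" a]) (simp_all add: nn_integral_density nn_integral_distr)

text \<open>
  This is the uniqueness argument for translation invariant measures. Write \<open>\<lambda>\<close> for the integral and
  \<open>g\<close> for the indicator of the unit ball. Evaluating the double integral of \<open>f (T x) * g (T x + y)\<close> in
  both orders, with \<open>x\<close> shifted by \<open>inv T y\<close> in one of them, gives \<open>\<lambda>(f \<circ> T) * \<lambda>(g) = \<lambda>(f) * \<lambda>(g \<circ> T)\<close>. Since \<open>T\<close>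
  preserves the ball, \<open>g \<circ> T = g\<close>, and the factor \<open>\<lambda>(g)\<close> cancels.
\<close>
lemma nn_integral_lborel_orthogonal:
  fixes f :: "'a::euclidean_space \<Rightarrow> ennreal" and T :: "'a \<Rightarrow> 'a"
  assumes T: "orthogonal_transformation T" and f[measurable]: "f \<in> borel_measurable borel"
  shows "(\<integral>\<^sup>+x. f (T x) \<partial>lborel) = (\<integral>\<^sup>+x. f x \<partial>lborel)"
proof -
  define g :: "'a \<Rightarrow> ennreal" where "g = indicator (ball 0 1)"
  have [measurable]: "g \<in> borel_measurable borel"
    unfolding g_def by (rule borel_measurable_indicator) simp
  have lin: "linear T" and inv: "T (inv T y) = y" for y
    using T orthogonal_transformation_surj[OF T]
    by (auto simp: orthogonal_transformation_linear surj_f_inv_f)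
  then have [measurable]: "T \<in> borel_measurable borel"
    by (intro borel_measurable_continuous_onI linear_continuous_on) (simp add: linear_linear)
  have gT: "g (T x) = g x" for x
    using orthogonal_transformation_norm[OF T] by (simp add: g_def indicator_def)
  let ?V = "\<integral>\<^sup>+x. g x \<partial>lborel"
  have V: "?V = emeasure lborel (ball (0::'a) 1)"
    by (simp add: g_def)
  have "(\<integral>\<^sup>+x. f (T x) \<partial>lborel) * ?V = (\<integral>\<^sup>+x. f (T x) * ?V \<partial>lborel)"
    by (simp add: nn_integral_multc)
  also have "\<dots> = (\<integral>\<^sup>+x. (\<integral>\<^sup>+y. f (T x) * g (T x + y) \<partial>lborel) \<partial>lborel)"
    by (simp add: nn_integral_cmult nn_integral_lborel_translate)
  also have "\<dots> = (\<integral>\<^sup>+y. (\<integral>\<^sup>+x. f (T x) * g (T x + y) \<partial>lborel) \<partial>lborel)"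
    by (rule lborel_pair.Fubini') simp
  also have "\<dots> = (\<integral>\<^sup>+y. (\<integral>\<^sup>+x. f (T x - y) * g (T x) \<partial>lborel) \<partial>lborel)"
  proof (rule nn_integral_cong)
    fix y :: 'a
    have "(\<integral>\<^sup>+x. f (T x - y) * g (T x) \<partial>lborel)
        = (\<integral>\<^sup>+x. f (T (inv T y + x) - y) * g (T (inv T y + x)) \<partial>lborel)"
      by (rule nn_integral_lborel_translate[symmetric]) simp
    then show "(\<integral>\<^sup>+x. f (T x) * g (T x + y) \<partial>lborel) = (\<integral>\<^sup>+x. f (T x - y) * g (T x) \<partial>lborel)"
      by (simp add: linear_add[OF lin] inv add.commute)
  qed
  also have "\<dots> = (\<integral>\<^sup>+x. (\<integral>\<^sup>+y. f (T x - y) * g (T x) \<partial>lborel) \<partial>lborel)"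
    by (rule lborel_pair.Fubini') simp
  also have "\<dots> = (\<integral>\<^sup>+x. f x \<partial>lborel) * ?V"
    by (simp add: nn_integral_multc nn_integral_cmult nn_integral_lborel_reflect gT)
  finally have eq: "(\<integral>\<^sup>+x. f (T x) \<partial>lborel) * ?V = (\<integral>\<^sup>+x. f x \<partial>lborel) * ?V" .
  have "unit_ball_vol (real DIM('a)) \<noteq> 0"
    using unit_ball_vol_pos[of "real DIM('a)"] by (metis of_nat_0_le_iff less_irrefl)
  then have "?V \<noteq> 0" "?V \<noteq> \<infinity>"
    unfolding V using emeasure_lborel_ball_finite[of "0::'a" 1]
    by (simp_all add: emeasure_ball)
  with eq show ?thesis
    by (simp add: ennreal_mult_cancel_left mult.commute[of _ ?V])
qed

lemma lborel_distr_orthogonal: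
  fixes T :: "'a::euclidean_space \<Rightarrow> 'a"
  assumes T: "orthogonal_transformation T"
  shows "distr lborel borel T = lborel"
proof (rule measure_eqI)
  have "linear T"
    using T by (rule orthogonal_transformation_linear)
  then have [measurable]: "T \<in> borel_measurable borel"
    by (intro borel_measurable_continuous_onI linear_continuous_on) (simp add: linear_linear)
  fix A assume "A \<in> sets (distr lborel borel T)"
  then have [measurable]: "A \<in> sets borel"
    by simp
  have "emeasure (distr lborel borel T) A = (\<integral>\<^sup>+x. indicator A x \<partial>distr lborel borel T)"
    by simp
  also have "\<dots> = (\<integral>\<^sup>+x. indicator A (T x) \<partial>lborel)"
    by (rule nn_integral_distr) auto
  also have "\<dots> = emeasure lborel A"
    by (simp add: nn_integral_lborel_orthogonal[OF T])
  finally show "emeasure (distr lborel borel T) A = emeasure lborel A" .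
qed simp

text \<open>
  An orthogonal map preserves both Lebesgue measure and the unit ball, and it commutes with radial
  projection.
\<close>
lemma uniform_sphere_distr_orthogonal:
  fixes T :: "real ^ 'n::finite \<Rightarrow> real ^ 'n"
  assumes T: "orthogonal_transformation T"
  shows "distr uniform_sphere borel T = uniform_sphere"
proof -
  let ?B = "ball 0 1 :: (real ^ 'n) set"
  let ?r = "\<lambda>x :: real ^ 'n. x /\<^sub>R norm x"
  have lin: "linear T"
    using T by (rule orthogonal_transformation_linear)
  then have mT[measurable]: "T \<in> borel_measurable borel"
    by (intro borel_measurable_continuous_onI linear_continuous_on) (simp add: linear_linear)
  have rT: "T (?r x) = ?r (T x)" for x
    by (simp add: linear_scale[OF lin] orthogonal_transformation_norm[OF T])
  have TB: "T x \<in> ?B \<longleftrightarrow> x \<in> ?B" for x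
    by (simp add: orthogonal_transformation_norm[OF T])
  have ball: "distr (uniform_measure lborel ?B) borel T = uniform_measure lborel ?B"
  proof (rule measure_eqI)
    fix A assume "A \<in> sets (distr (uniform_measure lborel ?B) borel T)"
    then have [measurable]: "A \<in> sets borel"
      by simp
    have "emeasure (distr (uniform_measure lborel ?B) borel T) A
        = emeasure lborel (?B \<inter> T -` A) / emeasure lborel ?B"
      using measurable_sets_borel[OF mT \<open>A \<in> sets borel\<close>] by (simp add: emeasure_distr)
    also have "?B \<inter> T -` A = T -` (?B \<inter> A)"
      using TB by blast
    also have "emeasure lborel (T -` (?B \<inter> A)) = emeasure (distr lborel borel T) (?B \<inter> A)"
      by (subst emeasure_distr) auto
    finally show "emeasure (distr (uniform_measure lborel ?B) borel T) A
        = emeasure (uniform_measure lborel ?B) A"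
      by (simp add: lborel_distr_orthogonal[OF T])
  qed simp
  have "distr uniform_sphere borel T = distr (uniform_measure lborel ?B) borel (T \<circ> ?r)"
    unfolding uniform_sphere_def by (rule distr_distr) auto
  also have "T \<circ> ?r = ?r \<circ> T"
    using rT by (simp add: fun_eq_iff)
  also have "distr (uniform_measure lborel ?B) borel (?r \<circ> T)
      = distr (distr (uniform_measure lborel ?B) borel T) borel ?r"
    by (rule distr_distr[symmetric]) auto
  finally show ?thesis
    by (simp add: ball uniform_sphere_def)
qed

section \<open>Congruent point configurations\<close>

definition reflect_along :: "'a::real_inner \<Rightarrow> 'a \<Rightarrow> 'a" where
  "reflect_along v u = u - (2 * (u \<bullet> v) / (v \<bullet> v)) *\<^sub>R v"

lemma orthogonal_transformation_reflect_along: "orthogonal_transformation (reflect_along v)"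
proof -
  have "linear (reflect_along v)"
    by (rule linearI) (simp_all add: reflect_along_def algebra_simps add_divide_distrib inner_simps)
  moreover have "reflect_along v u \<bullet> reflect_along v w = u \<bullet> w" for u w
    by (cases "v = 0")
      (simp_all add: reflect_along_def inner_diff_left inner_diff_right inner_commute field_simps)
  ultimately show ?thesis
    by (simp add: orthogonal_transformation_def)
qed

lemma reflect_along_fixes: "u \<bullet> v = 0 \<Longrightarrow> reflect_along v u = u"
  by (simp add: reflect_along_def)

lemma reflect_along_diff:
  assumes "a \<bullet> a = b \<bullet> b"
  shows "reflect_along (a - b) a = b"
proof (cases "a = b")
  case False
  then have "(a - b) \<bullet> (a - b) \<noteq> 0"
    by simp
  moreover have "2 * (a \<bullet> (a - b)) = (a - b) \<bullet> (a - b)"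
    using assms by (simp add: inner_diff_left inner_diff_right inner_commute)
  ultimately show ?thesis
    by (simp add: reflect_along_def)
qed (simp add: reflect_along_def)

text \<open>
  The map is a product of reflections, chosen one point at a time. If \<open>T\<close> already moves the first
  \<open>n\<close> points to their targets, the reflection exchanging \<open>T (p n)\<close> and \<open>q n\<close> fixes these targets:
  they have the same inner product with both points.
\<close>
lemma orthogonal_transformation_if_gram_eq:
  fixes p q :: "nat \<Rightarrow> 'a::euclidean_space"
  assumes "\<And>i j. i < n \<Longrightarrow> j < n \<Longrightarrow> p i \<bullet> p j = q i \<bullet> q j"
  obtains T where "orthogonal_transformation T" "\<And>i. i < n \<Longrightarrow> T (p i) = q i"
  using assms
proof (induction n arbitrary: thesis)
  case 0
  show ?case
    by (rule 0(1)[of "\<lambda>x. x"]) simp_all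
next
  case (Suc n)
  obtain T where T: "orthogonal_transformation T" and Tp: "\<And>i. i < n \<Longrightarrow> T (p i) = q i"
    by (rule Suc.IH) (simp_all add: Suc.prems(2))
  let ?S = "reflect_along (T (p n) - q n)"
  have inner: "T u \<bullet> T v = u \<bullet> v" for u v
    using T by (simp add: orthogonal_transformation_def)
  have "?S (T (p n)) = q n"
    by (rule reflect_along_diff) (simp add: inner Suc.prems(2))
  moreover have "?S (T (p i)) = q i" if "i < n" for i
  proof -
    have "q i \<bullet> T (p n) = q i \<bullet> q n"
      using inner[of "p i" "p n"] Tp[OF that] Suc.prems(2)[of i n] that by simp
    then show ?thesis
      using Tp[OF that] by (simp add: reflect_along_fixes inner_diff_right)
  qed
  ultimately show ?case
    using orthogonal_transformation_compose[OF orthogonal_transformation_reflect_along T]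
    by (intro Suc.prems(1)[of "?S \<circ> T"]) (auto simp: less_Suc_eq o_def)
qed

section \<open>Polynomial functions of bounded degree\<close>

lemma finite_exponents_le:
  "finite {e :: 'n::finite \<Rightarrow> nat. (\<Sum>i\<in>UNIV. e i) \<le> t}"
proof (rule finite_subset)
  show "{e :: 'n \<Rightarrow> nat. (\<Sum>i\<in>UNIV. e i) \<le> t} \<subseteq> UNIV \<rightarrow>\<^sub>E {..t}"
  proof
    fix e :: "'n \<Rightarrow> nat" assume "e \<in> {e. (\<Sum>i\<in>UNIV. e i) \<le> t}"
    then have "e i \<le> t" for i
      using member_le_sum[of i UNIV e] by simp
    then show "e \<in> UNIV \<rightarrow>\<^sub>E {..t}"
      by auto
  qed
qed (simp add: finite_PiE)

lemma polynomial_fun_le_monomial: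
  assumes "(\<Sum>i\<in>UNIV. e i) \<le> t"
  shows "polynomial_fun_le t (monomial_fun e)"
  unfolding polynomial_fun_le_def
proof (intro exI ext)
  fix x
  show "monomial_fun e x =
      (\<Sum>e' | (\<Sum>i\<in>UNIV. e' i) \<le> t. (if e' = e then 1 else 0) * monomial_fun e' x)"
    using assms by (subst sum.remove[of _ e]) (simp_all add: finite_exponents_le)
qed

lemma polynomial_fun_le_add:
  assumes "polynomial_fun_le t f" "polynomial_fun_le t g"
  shows "polynomial_fun_le t (\<lambda>x. f x + g x)"
proof -
  obtain c c' where "f = (\<lambda>x. \<Sum>e | (\<Sum>i\<in>UNIV. e i) \<le> t. c e * monomial_fun e x)"
    "g = (\<lambda>x. \<Sum>e | (\<Sum>i\<in>UNIV. e i) \<le> t. c' e * monomial_fun e x)"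
    using assms unfolding polynomial_fun_le_def by blast
  then show ?thesis
    unfolding polynomial_fun_le_def
    by (intro exI[of _ "\<lambda>e. c e + c' e"]) (simp add: sum.distrib distrib_right)
qed

lemma polynomial_fun_le_scale:
  assumes "polynomial_fun_le t f"
  shows "polynomial_fun_le t (\<lambda>x. a * f x)"
proof -
  obtain c where "f = (\<lambda>x. \<Sum>e | (\<Sum>i\<in>UNIV. e i) \<le> t. c e * monomial_fun e x)"
    using assms unfolding polynomial_fun_le_def by blast
  then show ?thesis
    unfolding polynomial_fun_le_def
    by (intro exI[of _ "\<lambda>e. a * c e"]) (simp add: sum_distrib_left mult.assoc)
qed

lemma polynomial_fun_le_const: "polynomial_fun_le t (\<lambda>x. a)"
  using polynomial_fun_le_scale[OF polynomial_fun_le_monomial[of "\<lambda>_. 0" t], of a]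
  by (simp add: monomial_fun_def)

lemma polynomial_fun_le_sum:
  "(\<And>i. i \<in> I \<Longrightarrow> polynomial_fun_le t (f i)) \<Longrightarrow> polynomial_fun_le t (\<lambda>x. \<Sum>i\<in>I. f i x)"
  by (induction I rule: infinite_finite_induct)
    (simp_all add: polynomial_fun_le_const polynomial_fun_le_add)

text \<open>
  Properties that are closed under linear combinations need to be checked on monomials only.
\<close>
lemma polynomial_fun_le_induct [consumes 1, case_names monomial sum scale]:
  assumes "polynomial_fun_le t f"
    and "\<And>e. (\<Sum>i\<in>UNIV. e i) \<le> t \<Longrightarrow> P (monomial_fun e)"
    and "\<And>(I :: ('n::finite \<Rightarrow> nat) set) g. finite I \<Longrightarrow> (\<And>i. i \<in> I \<Longrightarrow> P (g i)) \<Longrightarrow> P (\<lambda>x. \<Sum>i\<in>I. g i x)"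
    and "\<And>a g. P g \<Longrightarrow> P (\<lambda>x. a * g x)"
  shows "P (f :: real ^ 'n \<Rightarrow> real)"
proof -
  obtain c where f: "f = (\<lambda>x. \<Sum>e | (\<Sum>i\<in>UNIV. e i) \<le> t. c e * monomial_fun e x)"
    using assms(1) unfolding polynomial_fun_le_def by blast
  show ?thesis
    unfolding f by (intro assms(2-4)) (auto simp: finite_exponents_le)
qed

lemma polynomial_fun_le_mono:
  "polynomial_fun_le s f \<Longrightarrow> s \<le> t \<Longrightarrow> polynomial_fun_le t f"
  by (induction rule: polynomial_fun_le_induct)
    (auto intro: polynomial_fun_le_monomial polynomial_fun_le_sum polynomial_fun_le_scale)

lemma monomial_fun_mult: "monomial_fun e x * monomial_fun e' x = monomial_fun (\<lambda>i. e i + e' i) x"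
  by (simp add: monomial_fun_def power_add prod.distrib)

lemma polynomial_fun_le_mult:
  assumes f: "polynomial_fun_le s f" and g: "polynomial_fun_le t g"
  shows "polynomial_fun_le (s + t) (\<lambda>x. f x * g x)"
  using f
proof (induction rule: polynomial_fun_le_induct)
  case (monomial e)
  from g show ?case
  proof (induction rule: polynomial_fun_le_induct)
    case (monomial e')
    then show ?case
      using \<open>(\<Sum>i\<in>UNIV. e i) \<le> s\<close> polynomial_fun_le_monomial[of "\<lambda>i. e i + e' i" "s + t"]
      by (simp add: monomial_fun_mult sum.distrib)
  next
    case (sum I g)
    then show ?case
      by (simp add: sum_distrib_left polynomial_fun_le_sum)
  next
    case (scale a g)
    then show ?case
      using polynomial_fun_le_scale[of "s + t" "\<lambda>x. monomial_fun e x * g x" a]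
      by (simp add: ac_simps)
  qed
next
  case (sum I h)
  then show ?case
    by (simp add: sum_distrib_right polynomial_fun_le_sum)
next
  case (scale a h)
  then show ?case
    using polynomial_fun_le_scale[of "s + t" "\<lambda>x. h x * g x" a] by (simp add: ac_simps)
qed

lemma polynomial_fun_le_power:
  "polynomial_fun_le s f \<Longrightarrow> polynomial_fun_le (k * s) (\<lambda>x. f x ^ k)"
  by (induction k) (simp_all add: polynomial_fun_le_const polynomial_fun_le_mult)

lemma polynomial_fun_le_prod:
  "(\<And>i. i \<in> I \<Longrightarrow> polynomial_fun_le (k i) (f i)) \<Longrightarrow>
    polynomial_fun_le (\<Sum>i\<in>I. k i) (\<lambda>x. \<Prod>i\<in>I. f i x)"
  by (induction I rule: infinite_finite_induct)
    (simp_all add: polynomial_fun_le_const polynomial_fun_le_mult)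

lemma polynomial_fun_le_inner: "polynomial_fun_le 1 (\<lambda>x. x \<bullet> v)"
proof -
  have "polynomial_fun_le 1 (\<lambda>x. v $ i * x $ i)" for i
  proof -
    have "monomial_fun (\<lambda>j. if j = i then 1 else 0) = (\<lambda>x. x $ i)"
      unfolding monomial_fun_def by (subst prod.remove[of _ i]) auto
    then show ?thesis
      using polynomial_fun_le_monomial[of "\<lambda>j. if j = i then 1 else 0" 1]
      by (intro polynomial_fun_le_scale) simp
  qed
  then show ?thesis
    by (simp add: inner_vec_def mult.commute polynomial_fun_le_sum)
qed

lemma polynomial_fun_le_compose_linear:
  fixes T :: "real ^ 'n::finite \<Rightarrow> real ^ 'n"
  assumes f: "polynomial_fun_le t f" and T: "linear T"
  shows "polynomial_fun_le t (\<lambda>x. f (T x))"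
  using f
proof (induction rule: polynomial_fun_le_induct)
  case (monomial e)
  have "T x $ i = x \<bullet> adjoint T (axis i 1)" for x i
    by (simp add: adjoint_works[OF T] inner_axis)
  then have "polynomial_fun_le (e i * 1) (\<lambda>x. (T x $ i) ^ e i)" for i
    using polynomial_fun_le_power[OF polynomial_fun_le_inner] by simp
  then have "polynomial_fun_le (\<Sum>i\<in>UNIV. e i * 1) (\<lambda>x. monomial_fun e (T x))"
    unfolding monomial_fun_def by (intro polynomial_fun_le_prod)
  then show ?case
    using monomial by (simp add: polynomial_fun_le_mono)
qed (simp_all add: polynomial_fun_le_sum polynomial_fun_le_scale)

lemma borel_measurable_polynomial_fun_le:
  "polynomial_fun_le t f \<Longrightarrow> f \<in> borel_measurable borel"
proof (induction rule: polynomial_fun_le_induct)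
  case (monomial e)
  have "continuous_on UNIV (monomial_fun e)"
    unfolding monomial_fun_def by (intro continuous_intros)
  then show ?case
    by (rule borel_measurable_continuous_onI)
qed simp_all

section \<open>Moments of a spherical design\<close>

text \<open>
  The only consequence of the design property that the rest of the development uses: both sides are
  averages over the sphere. With it, all moments can be computed by finite sums.
\<close>
lemma spherical_design_sum_orthogonal:
  assumes X: "spherical_design t X" and f: "polynomial_fun_le t f"
    and T: "orthogonal_transformation T"
  shows "(\<Sum>x\<in>X. f (T x)) = (\<Sum>x\<in>X. f x)"
proof -
  have lin: "linear T"
    using T by (rule orthogonal_transformation_linear)
  then have mT: "T \<in> borel_measurable borel"
    by (intro borel_measurable_continuous_onI linear_continuous_on) (simp add: linear_linear)
  have sets: "sets uniform_sphere = sets borel"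
    by (simp add: uniform_sphere_def)
  have "(\<Sum>x\<in>X. f (T x)) / card X = (\<integral>x. f (T x) \<partial>uniform_sphere)"
    using X polynomial_fun_le_compose_linear[OF f lin] by (simp add: spherical_design_def)
  also have "\<dots> = (\<integral>x. f x \<partial>distr uniform_sphere borel T)"
    using mT borel_measurable_polynomial_fun_le[OF f]
    by (subst integral_distr) (simp_all add: measurable_cong_sets[OF sets refl])
  also have "\<dots> = (\<Sum>x\<in>X. f x) / card X"
    using X f by (simp add: uniform_sphere_distr_orthogonal[OF T] spherical_design_def)
  finally show ?thesis
    using X by (simp add: spherical_design_def)
qed

definition power_moment :: "'a::real_inner set \<Rightarrow> nat \<Rightarrow> 'a \<Rightarrow> real" where
  "power_moment X k u = (\<Sum>x\<in>X. (x \<bullet> u) ^ k)"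

lemma power_moment_norm_cong:
  assumes X: "spherical_design t X" and "k \<le> t" and uv: "norm u = norm v"
  shows "power_moment X k u = power_moment X k v"
proof -
  have "u \<bullet> u = v \<bullet> v"
    using uv by (simp add: norm_eq_sqrt_inner)
  then obtain T where T: "orthogonal_transformation T" and Tu: "T u = v"
    using orthogonal_transformation_if_gram_eq[of 1 "\<lambda>_. u" "\<lambda>_. v"] by auto
  have "polynomial_fun_le t (\<lambda>x. (x \<bullet> v) ^ k)"
    using polynomial_fun_le_power[OF polynomial_fun_le_inner] \<open>k \<le> t\<close>
    by (auto intro: polynomial_fun_le_mono)
  then have "(\<Sum>x\<in>X. (T x \<bullet> v) ^ k) = (\<Sum>x\<in>X. (x \<bullet> v) ^ k)"
    by (rule spherical_design_sum_orthogonal[OF X _ T])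
  moreover have "T x \<bullet> v = x \<bullet> u" for x
    using T by (simp add: orthogonal_transformation_def flip: Tu)
  ultimately show ?thesis
    by (simp add: power_moment_def)
qed

lemma power_moment_odd:
  assumes "spherical_design t X" "k \<le> t" "odd k"
  shows "power_moment X k u = 0"
proof -
  have "power_moment X k (- u) = - power_moment X k u"
    using \<open>odd k\<close> by (simp add: power_moment_def sum_negf)
  then show ?thesis
    using power_moment_norm_cong[OF assms(1,2), of "- u" u] by simp
qed

text \<open>
  The moment of order \<open>k + 2\<close> is constant along the great circle through \<open>u\<close> and \<open>v\<close>. The second
  derivative of a constant vanishes, and at \<open>u\<close> it is \<open>k + 2\<close> times the difference of both sides.
\<close>
lemma spherical_design_mixed_moment:
  fixes X :: "(real ^ 'n::finite) set"
  assumes X: "spherical_design t X" and k: "k + 2 \<le> t"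
    and unit: "norm u = 1" "norm v = 1" and orth: "u \<bullet> v = 0"
  shows "(k + 1) * (\<Sum>x\<in>X. (x \<bullet> u) ^ k * (x \<bullet> v)\<^sup>2) = power_moment X (k + 2) u"
proof -
  define w where "w \<theta> = cos \<theta> *\<^sub>R u + sin \<theta> *\<^sub>R v" for \<theta>
  define w' where "w' \<theta> = cos \<theta> *\<^sub>R v - sin \<theta> *\<^sub>R u" for \<theta>
  have inner: "u \<bullet> u = 1" "v \<bullet> v = 1" "v \<bullet> u = 0"
    using unit orth by (auto simp: norm_eq_1 inner_commute)
  have "w \<theta> \<bullet> w \<theta> = 1" for \<theta>
    using sin_cos_squared_add3[of \<theta>]
    by (simp add: w_def inner_add_left inner_add_right inner orth add.commute)
  then have const: "power_moment X (k + 2) (w \<theta>) = power_moment X (k + 2) u" for \<theta>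
    by (intro power_moment_norm_cong[OF X k]) (simp add: norm_eq_sqrt_inner inner)
  have dw: "((\<lambda>\<theta>. x \<bullet> w \<theta>) has_real_derivative x \<bullet> w' \<theta>) (at \<theta>)" for x \<theta>
    unfolding w_def w'_def inner_add_right inner_diff_right inner_scaleR_right
    by (auto intro!: derivative_eq_intros)
  have dw': "((\<lambda>\<theta>. x \<bullet> w' \<theta>) has_real_derivative - (x \<bullet> w \<theta>)) (at \<theta>)" for x \<theta>
    unfolding w_def w'_def inner_add_right inner_diff_right inner_scaleR_right
    by (auto intro!: derivative_eq_intros)
  have dpow: "((\<lambda>\<theta>. (x \<bullet> w \<theta>) ^ (m + 1)) has_real_derivative
      (m + 1) * (x \<bullet> w \<theta>) ^ m * (x \<bullet> w' \<theta>)) (at \<theta>)" for x \<theta> and m :: nat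
    using DERIV_power[OF dw, where n = "m + 1"] by (simp add: mult_ac)
  define g where "g \<theta> = (\<Sum>x\<in>X. (x \<bullet> w \<theta>) ^ (k + 1) * (x \<bullet> w' \<theta>))" for \<theta>
  have "((\<lambda>\<theta>. power_moment X (k + 2) (w \<theta>)) has_real_derivative (k + 2) * g \<theta>) (at \<theta>)" for \<theta>
    unfolding power_moment_def g_def sum_distrib_left
    by (rule DERIV_sum) (use dpow[of _ "k + 1"] in \<open>simp add: mult.assoc add.commute\<close>)
  then have "(k + 2) * g \<theta> = 0" for \<theta>
    unfolding const by (rule DERIV_unique) simp
  then have "g = (\<lambda>_. 0)"
    by auto
  moreover let ?D = "\<Sum>x\<in>X. (k + 1) * (x \<bullet> w 0) ^ k * (x \<bullet> w' 0) * (x \<bullet> w' 0)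
      - (x \<bullet> w 0) ^ (k + 1) * (x \<bullet> w 0)"
  have "(g has_real_derivative ?D) (at 0)"
    unfolding g_def
    by (rule DERIV_sum) (rule DERIV_cong[OF DERIV_mult[OF dpow dw']], simp add: algebra_simps)
  ultimately have "((\<lambda>_. 0) has_real_derivative ?D) (at 0)"
    by (simp only:)
  then have "?D = 0"
    by (rule DERIV_unique) simp
  moreover have "?D = (\<Sum>x\<in>X. (k + 1) * ((x \<bullet> u) ^ k * (x \<bullet> v)\<^sup>2) - (x \<bullet> u) ^ (k + 2))"
    by (simp add: w_def w'_def power2_eq_square mult_ac)
  ultimately show ?thesis
    by (simp only: power_moment_def sum_subtractf sum_distrib_left) (simp add: add.commute)
qed

text \<open>
  By invariance, \<open>u\<close> may be taken to be a member of the standard basis \<open>e\<close>. Insert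
  \<open>1 = \<Sum>j. (x \<bullet> e j)\<^sup>2\<close> into the moment of order \<open>k\<close>. The term with \<open>e j = u\<close> is the moment of
  order \<open>k + 2\<close>, and each of the other \<open>d - 1\<close> terms is \<open>1 / (k + 1)\<close> times it.
\<close>
lemma power_moment_recurrence:
  fixes X :: "(real ^ 'n::finite) set"
  assumes X: "spherical_design t X" and k: "k + 2 \<le> t" and u: "norm u = 1"
  shows "(CARD('n) + k) * power_moment X (k + 2) u = (k + 1) * power_moment X k u"
proof -
  obtain i :: 'n where True
    by blast
  define e :: "'n \<Rightarrow> real ^ 'n" where "e j = axis j 1" for j
  have e: "norm (e j) = 1" for j
    by (simp add: e_def)
  have sq: "(\<Sum>j\<in>UNIV. (x \<bullet> e j)\<^sup>2) = 1" if "x \<in> X" for x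
  proof -
    have "x \<bullet> x = 1"
      using X that by (auto simp: spherical_design_def norm_eq_1 subset_iff)
    moreover have "x \<bullet> e j = x $ j" for j
      by (simp add: e_def inner_axis)
    ultimately show ?thesis
      by (simp add: power2_eq_square inner_vec_def)
  qed
  have "(k + 1) * power_moment X k (e i)
      = (k + 1) * (\<Sum>x\<in>X. \<Sum>j\<in>UNIV. (x \<bullet> e i) ^ k * (x \<bullet> e j)\<^sup>2)"
    by (simp add: power_moment_def sq flip: sum_distrib_left)
  also have "\<dots> = (\<Sum>j\<in>UNIV. (k + 1) * (\<Sum>x\<in>X. (x \<bullet> e i) ^ k * (x \<bullet> e j)\<^sup>2))"
    by (subst sum.swap) (simp add: sum_distrib_left)
  also have "\<dots> = (k + 1) * power_moment X (k + 2) (e i)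
      + (\<Sum>j\<in>UNIV - {i}. (k + 1) * (\<Sum>x\<in>X. (x \<bullet> e i) ^ k * (x \<bullet> e j)\<^sup>2))"
    by (subst sum.remove[of _ i]) (simp_all add: power_moment_def power2_eq_square mult_ac)
  also have "(\<Sum>j\<in>UNIV - {i}. (k + 1) * (\<Sum>x\<in>X. (x \<bullet> e i) ^ k * (x \<bullet> e j)\<^sup>2))
      = (\<Sum>j\<in>UNIV - {i}. power_moment X (k + 2) (e i))"
  proof (rule sum.cong)
    fix j assume "j \<in> UNIV - {i}"
    then have "e i \<bullet> e j = 0"
      by (simp add: e_def inner_axis_axis)
    then show "(k + 1) * (\<Sum>x\<in>X. (x \<bullet> e i) ^ k * (x \<bullet> e j)\<^sup>2) = power_moment X (k + 2) (e i)"
      using spherical_design_mixed_moment[OF X k e e] by (simp add: add.commute)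
  qed simp
  also have "\<dots> = (real CARD('n) - 1) * power_moment X (k + 2) (e i)"
    by (simp add: card_Diff_singleton of_nat_diff)
  finally have "(CARD('n) + k) * power_moment X (k + 2) (e i) = (k + 1) * power_moment X k (e i)"
    by (simp add: algebra_simps)
  moreover have "power_moment X j (e i) = power_moment X j u" if "j \<le> t" for j
    using X that by (rule power_moment_norm_cong) (simp add: e u)
  ultimately show ?thesis
    using k by simp
qed

section \<open>The inner products of a tight design\<close>

text \<open>
  The two sums say that \<open>(1 + u) * (g u)\<^sup>2\<close>, at \<open>u = y \<bullet> x\<close>, has total \<open>2 * (g 1)\<^sup>2\<close> over \<open>X\<close>. The
  point \<open>x\<close> alone contributes that much and all contributions are nonnegative, so the others vanish.
  If \<open>- x\<close> were not in \<open>X\<close>, then \<open>(g u)\<^sup>2\<close> would have total only \<open>(g 1)\<^sup>2\<close>.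
\<close>
lemma antipodal_and_roots_if_annihilator_extremal:
  fixes X :: "(real ^ 'n::finite) set" and g :: "real \<Rightarrow> real"
  assumes X: "finite X" "X \<subseteq> sphere 0 1" and x: "x \<in> X"
    and g1: "g 1 \<noteq> 0"
    and even: "(\<Sum>y\<in>X. (g (y \<bullet> x))\<^sup>2) = 2 * (g 1)\<^sup>2"
    and odd: "(\<Sum>y\<in>X. (y \<bullet> x) * (g (y \<bullet> x))\<^sup>2) = 0"
  shows "- x \<in> X" and "\<And>y. y \<in> X \<Longrightarrow> y \<bullet> x \<in> {1, - 1} \<union> {u. g u = 0}"
proof -
  have unit: "y \<bullet> y = 1" if "y \<in> X" for y
    using X that by (auto simp: norm_eq_1 subset_iff)
  have ge: "y \<bullet> x \<ge> - 1" if "y \<in> X" for y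
    using norm_cauchy_schwarz[of "- y" x] X that x by (auto simp: subset_iff)
  have neg: "y = - x" if "y \<in> X" "y \<bullet> x = - 1" for y
  proof -
    have "(y + x) \<bullet> (y + x) = 0"
      using that unit x by (simp add: inner_add_left inner_add_right inner_commute)
    then show ?thesis
      by (simp add: add_eq_0_iff2)
  qed
  have "(\<Sum>y\<in>X. (1 + y \<bullet> x) * (g (y \<bullet> x))\<^sup>2) = 2 * (g 1)\<^sup>2"
    using even odd by (simp add: distrib_right sum.distrib)
  then have "(\<Sum>y\<in>X - {x}. (1 + y \<bullet> x) * (g (y \<bullet> x))\<^sup>2) = 0"
    using X x by (simp add: sum.remove[of X x] unit)
  moreover have "0 \<le> (1 + y \<bullet> x) * (g (y \<bullet> x))\<^sup>2" if "y \<in> X - {x}" for y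
    using ge[of y] that by (intro mult_nonneg_nonneg) auto
  ultimately have zero: "y \<bullet> x = - 1 \<or> g (y \<bullet> x) = 0" if "y \<in> X - {x}" for y
    using that X by (subst (asm) sum_nonneg_eq_0_iff) (auto simp: add_eq_0_iff2)
  then show "y \<bullet> x \<in> {1, - 1} \<union> {u. g u = 0}" if "y \<in> X" for y
    using that unit[of x] x by (cases "y = x") auto
  show "- x \<in> X"
  proof (rule ccontr)
    assume "- x \<notin> X"
    then have "g (y \<bullet> x) = 0" if "y \<in> X - {x}" for y
      using zero[OF that] neg[of y] that by auto
    then have "(\<Sum>y\<in>X. (g (y \<bullet> x))\<^sup>2) = (g 1)\<^sup>2"
      using X x by (simp add: sum.remove[of X x] unit)
    then show False
      using even g1 by simp
  qed
qed

text \<open>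
  The moments of orders \<open>0\<close>, \<open>2\<close>, \<open>4\<close> in a tight 5-design are \<open>d * (d + 1)\<close>, \<open>d + 1\<close> and
  \<open>3 * (d + 1) / (d + 2)\<close>. The constant \<open>c = 1 / (d + 2)\<close> is the one for which
  \<open>(1 + u) * (u\<^sup>2 - c)\<^sup>2\<close> yields the sharp lower bound on the size of a 5-design.
\<close>
lemma tight_5_design_inner_products:
  fixes X :: "(real ^ 'n::finite) set"
  assumes tight: "tight_spherical_design 5 X" and x: "x \<in> X"
  defines "\<beta> \<equiv> sqrt (1 / (CARD('n) + 2))"
  shows "- x \<in> X" and "\<And>y. y \<in> X \<Longrightarrow> y \<bullet> x \<in> {1, - 1} \<union> {\<beta>, - \<beta>}"
proof -
  have X: "spherical_design 5 X" and cardX: "card X = 2 * ((CARD('n) + 1) choose 2)"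
    using tight by (simp_all add: tight_spherical_design_def)
  have fin: "finite X" and sph: "X \<subseteq> sphere 0 1" and x1: "norm x = 1"
    using X x by (auto simp: spherical_design_def subset_iff)
  let ?d = "real CARD('n)" and ?p = "\<lambda>k. power_moment X k x"
  define c where "c = 1 / (?d + 2)"
  define g :: "real \<Rightarrow> real" where "g u = u\<^sup>2 - c" for u
  have d: "?d > 0"
    by simp
  have "even (CARD('n) * (CARD('n) + 1))"
    by simp
  then have "card X = CARD('n) * (CARD('n) + 1)"
    unfolding cardX by (simp add: choose_two mult.commute)
  then have p0: "?p 0 = ?d * (?d + 1)"
    by (simp add: power_moment_def algebra_simps)
  then have p2: "?p 2 = ?d + 1"
    using power_moment_recurrence[OF X _ x1, of 0] d by (simp add: numeral_2_eq_2)
  have p4: "?p 4 = 3 * (?d + 1) / (?d + 2)"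
    using power_moment_recurrence[OF X _ x1, of 2] p2 d by (simp add: field_simps)
  have odd: "?p 1 = 0" "?p 3 = 0" "?p 5 = 0"
    using power_moment_odd[OF X] by simp_all
  have g2: "(g u)\<^sup>2 = u ^ 4 - 2 * c * u ^ 2 + c\<^sup>2 * u ^ 0" for u
    unfolding g_def by simp algebra
  have ug2: "u * (g u)\<^sup>2 = u ^ 5 - 2 * c * u ^ 3 + c\<^sup>2 * u ^ 1" for u
    unfolding g_def by simp algebra
  have "(\<Sum>y\<in>X. (g (y \<bullet> x))\<^sup>2) = ?p 4 - 2 * c * ?p 2 + c\<^sup>2 * ?p 0"
    unfolding g2 power_moment_def by (simp only: sum.distrib sum_subtractf sum_distrib_left)
  also have "\<dots> = 2 * (g 1)\<^sup>2"
    unfolding p0 p2 p4 g_def c_def using d by (simp add: divide_simps) algebra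
  finally have even_sum: "(\<Sum>y\<in>X. (g (y \<bullet> x))\<^sup>2) = 2 * (g 1)\<^sup>2" .
  have "(\<Sum>y\<in>X. (y \<bullet> x) * (g (y \<bullet> x))\<^sup>2)
      = ?p 5 - 2 * c * ?p 3 + c\<^sup>2 * ?p 1"
    unfolding ug2 power_moment_def by (simp only: sum.distrib sum_subtractf sum_distrib_left)
  then have odd_sum: "(\<Sum>y\<in>X. (y \<bullet> x) * (g (y \<bullet> x))\<^sup>2) = 0"
    unfolding odd by simp
  have g1: "g 1 \<noteq> 0"
    using d by (simp add: g_def c_def field_simps)
  have roots: "{u. g u = 0} \<subseteq> {\<beta>, - \<beta>}"
  proof
    fix u assume "u \<in> {u. g u = 0}"
    then have "u\<^sup>2 = \<beta>\<^sup>2"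
      by (simp add: g_def c_def \<beta>_def)
    then show "u \<in> {\<beta>, - \<beta>}"
      by (simp add: power2_eq_iff)
  qed
  show "- x \<in> X"
    by (rule antipodal_and_roots_if_annihilator_extremal[OF fin sph x g1 even_sum odd_sum])
  show "y \<bullet> x \<in> {1, - 1} \<union> {\<beta>, - \<beta>}" if "y \<in> X" for y
    using antipodal_and_roots_if_annihilator_extremal(2)[OF fin sph x g1 even_sum odd_sum that] roots by blast
qed

text \<open>
  The same argument with \<open>c = 3 / (d + 4)\<close>. The moments of orders \<open>2\<close>, \<open>4\<close>, \<open>6\<close> are
  \<open>(d + 1) * (d + 2) / 3\<close>, \<open>d + 1\<close> and \<open>5 * (d + 1) / (d + 4)\<close>.
\<close>
lemma tight_7_design_inner_products:
  fixes X :: "(real ^ 'n::finite) set"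
  assumes tight: "tight_spherical_design 7 X" and x: "x \<in> X"
  defines "\<beta> \<equiv> sqrt (3 / (CARD('n) + 4))"
  shows "- x \<in> X" and "\<And>y. y \<in> X \<Longrightarrow> y \<bullet> x \<in> {1, - 1} \<union> {0, \<beta>, - \<beta>}"
proof -
  have X: "spherical_design 7 X" and cardX: "card X = 2 * ((CARD('n) + 2) choose 3)"
    using tight by (simp_all add: tight_spherical_design_def)
  have fin: "finite X" and sph: "X \<subseteq> sphere 0 1" and x1: "norm x = 1"
    using X x by (auto simp: spherical_design_def subset_iff)
  let ?d = "real CARD('n)" and ?p = "\<lambda>k. power_moment X k x"
  define c where "c = 3 / (?d + 4)"
  define g :: "real \<Rightarrow> real" where "g u = u * (u\<^sup>2 - c)" for u
  have d: "?d > 0"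
    by simp
  have "even (CARD('n) * (CARD('n) + 1))"
    by simp
  then have two: "2 * ((CARD('n) + 1) choose 2) = CARD('n) * (CARD('n) + 1)"
    by (simp add: choose_two mult.commute)
  have "3 * card X = 2 * (3 * ((CARD('n) + 2) choose 3))"
    by (simp add: cardX)
  also have "3 * ((CARD('n) + 2) choose 3) = (CARD('n) + 2) * ((CARD('n) + 1) choose 2)"
    using Suc_times_binomial_eq[of "CARD('n) + 1" 2] by (simp add: numeral_3_eq_3 mult.commute)
  also have "2 * \<dots> = (CARD('n) + 2) * (2 * ((CARD('n) + 1) choose 2))"
    by simp
  finally have "3 * card X = CARD('n) * (CARD('n) + 1) * (CARD('n) + 2)"
    unfolding two by simp
  then have "real (3 * card X) = real (CARD('n) * (CARD('n) + 1) * (CARD('n) + 2))"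
    by (rule arg_cong)
  then have p0: "?p 0 = ?d * (?d + 1) * (?d + 2) / 3"
    by (simp add: power_moment_def algebra_simps)
  moreover have "?d * ?p 2 = ?p 0"
    using power_moment_recurrence[OF X _ x1, of 0] by (simp add: numeral_2_eq_2)
  ultimately have "?d * ?p 2 = ?d * ((?d + 1) * (?d + 2) / 3)"
    by simp
  then have p2: "?p 2 = (?d + 1) * (?d + 2) / 3"
    using d by simp
  have "(?d + 2) * ?p 4 = 3 * ?p 2"
    using power_moment_recurrence[OF X _ x1, of 2] by (simp add: add.commute)
  also have "\<dots> = (?d + 2) * (?d + 1)"
    unfolding p2 by simp
  finally have "(?d + 2) * ?p 4 = (?d + 2) * (?d + 1)" .
  then have p4: "?p 4 = ?d + 1"
    using d by simp
  have p6: "?p 6 = 5 * (?d + 1) / (?d + 4)"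
    using power_moment_recurrence[OF X _ x1, of 4] p4 d by (simp add: field_simps)
  have odd: "?p 3 = 0" "?p 5 = 0" "?p 7 = 0"
    using power_moment_odd[OF X] by simp_all
  have g2: "(g u)\<^sup>2 = u ^ 6 - 2 * c * u ^ 4 + c\<^sup>2 * u ^ 2" for u
    unfolding g_def by algebra
  have ug2: "u * (g u)\<^sup>2 = u ^ 7 - 2 * c * u ^ 5 + c\<^sup>2 * u ^ 3" for u
    unfolding g_def by algebra
  have "(\<Sum>y\<in>X. (g (y \<bullet> x))\<^sup>2) = ?p 6 - 2 * c * ?p 4 + c\<^sup>2 * ?p 2"
    unfolding g2 power_moment_def by (simp only: sum.distrib sum_subtractf sum_distrib_left)
  also have "\<dots> = 2 * (g 1)\<^sup>2"
    unfolding p2 p4 p6 g_def c_def using d by (simp add: divide_simps) algebra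
  finally have even_sum: "(\<Sum>y\<in>X. (g (y \<bullet> x))\<^sup>2) = 2 * (g 1)\<^sup>2" .
  have "(\<Sum>y\<in>X. (y \<bullet> x) * (g (y \<bullet> x))\<^sup>2)
      = ?p 7 - 2 * c * ?p 5 + c\<^sup>2 * ?p 3"
    unfolding ug2 power_moment_def by (simp only: sum.distrib sum_subtractf sum_distrib_left)
  then have odd_sum: "(\<Sum>y\<in>X. (y \<bullet> x) * (g (y \<bullet> x))\<^sup>2) = 0"
    unfolding odd by simp
  have g1: "g 1 \<noteq> 0"
    using d by (simp add: g_def c_def field_simps)
  have roots: "{u. g u = 0} \<subseteq> {0, \<beta>, - \<beta>}"
  proof
    fix u assume "u \<in> {u. g u = 0}"
    then have "u = 0 \<or> u\<^sup>2 = \<beta>\<^sup>2"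
      by (simp add: g_def c_def \<beta>_def)
    then show "u \<in> {0, \<beta>, - \<beta>}"
      by (auto simp: power2_eq_iff)
  qed
  show "- x \<in> X"
    by (rule antipodal_and_roots_if_annihilator_extremal[OF fin sph x g1 even_sum odd_sum])
  show "y \<bullet> x \<in> {1, - 1} \<union> {0, \<beta>, - \<beta>}" if "y \<in> X" for y
    using antipodal_and_roots_if_annihilator_extremal(2)[OF fin sph x g1 even_sum odd_sum that] roots by blast
qed

text \<open>
  The bound on \<open>card B\<close> is the degree condition for three Lagrange basis polynomials on \<open>B\<close>: a set
  \<open>B\<close> of size \<open>2\<close> gives \<open>3 \<le> 5\<close>, a set of size \<open>3\<close> gives \<open>6 \<le> 7\<close>.
\<close>
lemma tight_design_structure:
  fixes X :: "(real ^ 'n::finite) set"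
  assumes tight: "tight_spherical_design t X" and t: "t \<in> {5, 7}"
  obtains B where "finite B" "3 * (card B - 1) \<le> t" "\<And>x. x \<in> X \<Longrightarrow> - x \<in> X"
    "\<And>x y. x \<in> X \<Longrightarrow> y \<in> X \<Longrightarrow> x \<bullet> y \<in> {1, - 1} \<union> B"
proof (cases "t = 5")
  case True
  let ?b = "sqrt (1 / (CARD('n) + 2))"
  have "card {?b, - ?b} \<le> 2"
    by (simp add: card_insert_if)
  then show ?thesis
    using tight_5_design_inner_products[OF tight[unfolded True]] True by (intro that[of "{?b, - ?b}"]) auto
next
  case False
  then have 7: "t = 7"
    using t by simp
  let ?b = "sqrt (3 / (CARD('n) + 4))"
  have "card {0, ?b, - ?b} \<le> 3"
    by (simp add: card_insert_if)
  then show ?thesis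
    using tight_7_design_inner_products[OF tight[unfolded 7]] 7 by (intro that[of "{0, ?b, - ?b}"]) auto
qed

section \<open>Counting points with prescribed inner products\<close>

definition lagrange_basis :: "real set \<Rightarrow> real \<Rightarrow> real \<Rightarrow> real" where
  "lagrange_basis B b u = (\<Prod>c\<in>B - {b}. (u - c) / (b - c))"

lemma lagrange_basis_eq:
  assumes "finite B" "u \<in> B"
  shows "lagrange_basis B b u = of_bool (u = b)"
proof (cases "u = b")
  case True
  have "(\<Prod>c\<in>B - {b}. (b - c) / (b - c)) = 1"
    by (rule prod.neutral) auto
  then show ?thesis
    using True by (simp add: lagrange_basis_def)
next
  case False
  then show ?thesis
    using assms by (simp add: lagrange_basis_def)
qed

lemma polynomial_fun_le_lagrange_basis:
  assumes "finite B" "b \<in> B"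
  shows "polynomial_fun_le (card B - 1) (\<lambda>w. lagrange_basis B b (w \<bullet> v))"
proof -
  have "polynomial_fun_le 1 (\<lambda>w. (w \<bullet> v - c) / (b - c))" for c
    using polynomial_fun_le_scale[OF polynomial_fun_le_add[OF polynomial_fun_le_inner[of v]
        polynomial_fun_le_const[of 1 "- c"]], of "1 / (b - c)"]
    by simp
  then have "polynomial_fun_le (\<Sum>c\<in>B - {b}. 1) (\<lambda>w. lagrange_basis B b (w \<bullet> v))"
    unfolding lagrange_basis_def by (intro polynomial_fun_le_prod)
  then show ?thesis
    using assms by simp
qed

text \<open>
  Split \<open>X\<close> into the set \<open>E v\<close> of the points \<open>v i\<close>, \<open>- v i\<close> and the rest. The orthogonal map \<open>T\<close> with \<open>T (p i) = q i\<close> restricts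
  to a bijection from \<open>E p\<close> to \<open>E q\<close>, both inside \<open>X\<close>, that preserves the condition counted. Off \<open>E v\<close>
  the inner products with the \<open>v i\<close> lie in \<open>B\<close>, so that the condition is the polynomial \<open>h v\<close> of
  degree at most \<open>r * (card B - 1)\<close>. Its total over \<open>X\<close> is the same for \<open>p\<close> and \<open>q\<close> by the design
  property, and its total over \<open>E v\<close> by the bijection.
\<close>
lemma joint_inner_product_count_cong:
  fixes X :: "(real ^ 'n::finite) set" and p q :: "nat \<Rightarrow> real ^ 'n" and a :: "nat \<Rightarrow> real"
  assumes X: "spherical_design t X" and B: "finite B" "r * (card B - 1) \<le> t"
    and antipodal: "\<And>x. x \<in> X \<Longrightarrow> - x \<in> X"
    and inner_products: "\<And>x y. x \<in> X \<Longrightarrow> y \<in> X \<Longrightarrow> x \<bullet> y \<in> {1, - 1} \<union> B"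
    and pX: "\<And>i. i < r \<Longrightarrow> p i \<in> X" and qX: "\<And>i. i < r \<Longrightarrow> q i \<in> X"
    and gram: "\<And>i j. i < r \<Longrightarrow> j < r \<Longrightarrow> p i \<bullet> p j = q i \<bullet> q j"
  shows "card {w \<in> X. \<forall>i<r. w \<bullet> p i = a i} = card {w \<in> X. \<forall>i<r. w \<bullet> q i = a i}"
proof -
  obtain T where T: "orthogonal_transformation T" and Tp: "\<And>i. i < r \<Longrightarrow> T (p i) = q i"
    using orthogonal_transformation_if_gram_eq[of r p q] gram by blast
  have inj: "inj_on T S" for S
    using orthogonal_transformation_inj[OF T] by (rule inj_on_subset) simp
  have Tq: "T w \<bullet> q i = w \<bullet> p i" if "i < r" for w i
    using T Tp[OF that] by (metis orthogonal_transformation_def)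
  have fin: "finite X" and unit: "\<And>x. x \<in> X \<Longrightarrow> x \<bullet> x = 1"
    using X by (auto simp: spherical_design_def norm_eq_1 subset_iff)
  define E where "E v = (\<Union>i<r. {v i, - v i})" for v :: "nat \<Rightarrow> real ^ 'n"
  have EX: "E p \<subseteq> X" "E q \<subseteq> X"
    using pX qX antipodal by (auto simp: E_def)
  have TE: "T ` E p = E q"
    using Tp by (auto simp: E_def image_UN linear_neg[OF orthogonal_transformation_linear[OF T]])
  have outside: "w \<bullet> v i \<in> B" if "w \<in> X - E v" "i < r" "v i \<in> X" for w v i
  proof -
    have "w \<noteq> v i" "w \<noteq> - v i"
      using that by (auto simp: E_def)
    then have "(w - v i) \<bullet> (w - v i) \<noteq> 0" "(w + v i) \<bullet> (w + v i) \<noteq> 0"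
      by (simp_all add: eq_neg_iff_add_eq_0)
    then have "w \<bullet> v i \<noteq> 1" "w \<bullet> v i \<noteq> - 1"
      using unit that by (auto simp: inner_diff_left inner_diff_right inner_add_left inner_add_right inner_commute)
    then show ?thesis
      using inner_products[of w "v i"] that by auto
  qed
  define S where "S v D = {w \<in> D. \<forall>i<r. w \<bullet> v i = a i}" for v :: "nat \<Rightarrow> real ^ 'n" and D
  have split: "card (S v X) = card (S v (E v)) + card (S v (X - E v))" if "E v \<subseteq> X" for v
    using fin that unfolding S_def
    by (subst card_Un_disjoint[symmetric]) (auto intro!: arg_cong[of _ _ card] intro: finite_subset)
  have "T ` S p (E p) = S q (E q)"
    unfolding S_def TE[symmetric] using Tq by auto
  then have inside: "card (S p (E p)) = card (S q (E q))"
    using card_image[OF inj] by metis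
  have rest: "card (S p (X - E p)) = card (S q (X - E q))"
  proof (cases "\<forall>i<r. a i \<in> B")
    case False
    then have "S p (X - E p) = {}" "S q (X - E q) = {}"
      using outside pX qX unfolding S_def by fastforce+
    then show ?thesis
      by simp
  next
    case True
    define h where "h v w = (\<Prod>i<r. lagrange_basis B (a i) (w \<bullet> v i))"
      for v :: "nat \<Rightarrow> real ^ 'n" and w
    have "polynomial_fun_le (\<Sum>i<r. card B - 1) (h v)" for v
      unfolding h_def
      by (intro polynomial_fun_le_prod polynomial_fun_le_lagrange_basis) (use True B in auto)
    then have "polynomial_fun_le t (h q)"
      by (rule polynomial_fun_le_mono) (use B in simp)
    then have "(\<Sum>w\<in>X. h q (T w)) = (\<Sum>w\<in>X. h q w)"
      by (rule spherical_design_sum_orthogonal[OF X _ T])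
    moreover have hT: "h q (T w) = h p w" for w
      unfolding h_def by (simp add: Tq)
    ultimately have total: "(\<Sum>w\<in>X. h p w) = (\<Sum>w\<in>X. h q w)"
      by simp
    have "(\<Sum>w\<in>E q. h q w) = (\<Sum>w\<in>E p. h p w)"
      unfolding TE[symmetric] by (simp add: sum.reindex[OF inj] hT)
    with total have diff: "(\<Sum>w\<in>X - E p. h p w) = (\<Sum>w\<in>X - E q. h q w)"
      using fin EX by (simp add: sum_diff)
    have count: "(\<Sum>w\<in>X - E v. h v w) = card (S v (X - E v))" if "\<And>i. i < r \<Longrightarrow> v i \<in> X" for v
    proof -
      have "h v w = of_bool (\<forall>i<r. w \<bullet> v i = a i)" if "w \<in> X - E v" for w
      proof -
        have "h v w = (\<Prod>i<r. of_bool (w \<bullet> v i = a i))"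
          unfolding h_def
          using outside[of w v] that \<open>\<And>i. i < r \<Longrightarrow> v i \<in> X\<close> B
          by (intro prod.cong refl lagrange_basis_eq) auto
        also have "\<dots> = of_bool (\<forall>i<r. w \<bullet> v i = a i)"
          by (cases "\<forall>i<r. w \<bullet> v i = a i") (auto intro!: prod.neutral)
        finally show ?thesis .
      qed
      then have "(\<Sum>w\<in>X - E v. h v w) = (\<Sum>w\<in>X - E v. of_bool (\<forall>i<r. w \<bullet> v i = a i))"
        by (intro sum.cong) auto
      also have "\<dots> = card (S v (X - E v))"
        using fin by (simp add: S_def Int_def of_bool_def sum.If_cases)
      finally show ?thesis .
    qed
    show ?thesis
      using diff count[of p] count[of q] pX qX by simp
  qed
  show ?thesis
    using split[OF EX(1)] split[OF EX(2)] inside rest unfolding S_def by simp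
qed

section \<open>Triple regularity\<close>

theorem corollary3p2:
  fixes X :: "(real ^ 'n::finite) set"
    and t s :: nat
    and \<alpha> :: "nat \<Rightarrow> real"
    and R :: "nat \<Rightarrow> ((real ^ 'n) \<times> (real ^ 'n)) set"
  assumes "CARD('n) \<ge> 3"
    and "t \<in> {5, 7}"
    and "tight_spherical_design t X"
    and "inj_on \<alpha> {1..s}"
    and "\<alpha> ` {1..s} = {x \<bullet> y | x y. x \<in> X \<and> y \<in> X \<and> x \<noteq> y}"
    and "\<alpha> 0 = 1"
    and "\<And>k. k \<le> s \<Longrightarrow> R k = {(x, y). x \<in> X \<and> y \<in> X \<and> x \<bullet> y = \<alpha> k}"
  shows "triply_regular_association_scheme X s R"
proof -
  note R = assms(7)
  have X: "spherical_design t X"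
    using assms(3) by (simp add: tight_spherical_design_def)
  then have fin: "finite X" and "X \<noteq> {}" and unit: "\<And>x. x \<in> X \<Longrightarrow> x \<bullet> x = 1"
    by (auto simp: spherical_design_def norm_eq_1 subset_iff)
  obtain B where B: "finite B" "3 * (card B - 1) \<le> t"
    and antipodal: "\<And>x. x \<in> X \<Longrightarrow> - x \<in> X"
    and inner_products: "\<And>x y. x \<in> X \<Longrightarrow> y \<in> X \<Longrightarrow> x \<bullet> y \<in> {1, - 1} \<union> B"
    using tight_design_structure[OF assms(3,2)] by blast
  have eq: "x = y" if "x \<in> X" "y \<in> X" "x \<bullet> y = 1" for x y
  proof -
    have "(x - y) \<bullet> (x - y) = 0"
      using that unit by (simp add: inner_diff_left inner_diff_right inner_commute)
    then show ?thesis
      by simp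
  qed
  have \<alpha>_ne_1: "\<alpha> k \<noteq> 1" if "k \<in> {1..s}" for k
  proof -
    have "\<alpha> k \<in> {x \<bullet> y | x y. x \<in> X \<and> y \<in> X \<and> x \<noteq> y}"
      unfolding assms(5)[symmetric] using that by (rule imageI)
    then show ?thesis
      using eq by auto
  qed
  have inj: "inj_on \<alpha> {..s}"
  proof -
    have "{..s} = insert 0 {1..s}"
      by auto
    then show ?thesis
      using assms(4,6) \<alpha>_ne_1 by (auto simp: inj_on_insert)
  qed
  \<comment> \<open>The three-point case, with the triples as lists so that the index set is the set of i < 3.\<close>
  have triple: "card {w \<in> X. w \<bullet> x = a \<and> w \<bullet> y = b \<and> w \<bullet> z = c}
      = card {w \<in> X. w \<bullet> x' = a \<and> w \<bullet> y' = b \<and> w \<bullet> z' = c}"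
    if X3: "x \<in> X" "y \<in> X" "z \<in> X" "x' \<in> X" "y' \<in> X" "z' \<in> X"
      and gram: "x \<bullet> y = x' \<bullet> y'" "y \<bullet> z = y' \<bullet> z'" "z \<bullet> x = z' \<bullet> x'" for x y z x' y' z' a b c
  proof -
    let ?p = "\<lambda>i. [x, y, z] ! i" and ?q = "\<lambda>i. [x', y', z'] ! i" and ?a = "\<lambda>i. [a, b, c] ! i"
    have all3: "(\<forall>i<3. P i) \<longleftrightarrow> P 0 \<and> P 1 \<and> P 2" for P :: "nat \<Rightarrow> bool"
      by (auto simp: numeral_3_eq_3 numeral_2_eq_2 less_Suc_eq)
    have "\<forall>i<3. ?p i \<in> X \<and> ?q i \<in> X" "\<forall>i<3. \<forall>j<3. ?p i \<bullet> ?p j = ?q i \<bullet> ?q j"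
      unfolding all3 using X3 gram unit by (simp_all add: inner_commute)
    then have "card {w \<in> X. \<forall>i<3. w \<bullet> ?p i = ?a i} = card {w \<in> X. \<forall>i<3. w \<bullet> ?q i = ?a i}"
      by (intro joint_inner_product_count_cong[OF X B antipodal inner_products]) auto
    then show ?thesis
      unfolding all3 by simp
  qed
  have regular: "\<exists>p. \<forall>x\<in>X. \<forall>y\<in>X. \<forall>z\<in>X.
      (x, y) \<in> R i \<longrightarrow> (y, z) \<in> R j \<longrightarrow> (z, x) \<in> R k \<longrightarrow>
      card {w \<in> X. (w, x) \<in> R m \<and> (w, y) \<in> R n \<and> (w, z) \<in> R l} = p"
    if idx: "i \<le> s" "j \<le> s" "k \<le> s" "l \<le> s" "m \<le> s" "n \<le> s" for i j k l m n
  proof (cases "\<exists>x\<in>X. \<exists>y\<in>X. \<exists>z\<in>X. x \<bullet> y = \<alpha> i \<and> y \<bullet> z = \<alpha> j \<and> z \<bullet> x = \<alpha> k")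
    case True
    then obtain x y z where xyz: "x \<in> X" "y \<in> X" "z \<in> X"
      "x \<bullet> y = \<alpha> i" "y \<bullet> z = \<alpha> j" "z \<bullet> x = \<alpha> k"
      by blast
    have count: "{w \<in> X. (w, u) \<in> R m \<and> (w, v) \<in> R n \<and> (w, u') \<in> R l}
        = {w \<in> X. w \<bullet> u = \<alpha> m \<and> w \<bullet> v = \<alpha> n \<and> w \<bullet> u' = \<alpha> l}"
      if "u \<in> X" "v \<in> X" "u' \<in> X" for u v u'
      using that idx by (auto simp: R)
    show ?thesis
    proof (intro exI ballI impI)
      fix u v u' assume X3: "u \<in> X" "v \<in> X" "u' \<in> X"
        and R3: "(u, v) \<in> R i" "(v, u') \<in> R j" "(u', u) \<in> R k"
      show "card {w \<in> X. (w, u) \<in> R m \<and> (w, v) \<in> R n \<and> (w, u') \<in> R l}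
          = card {w \<in> X. w \<bullet> x = \<alpha> m \<and> w \<bullet> y = \<alpha> n \<and> w \<bullet> z = \<alpha> l}"
        unfolding count[OF X3] using R3 idx xyz X3 by (intro triple) (auto simp: R)
    qed
  next
    case False
    then show ?thesis
      using idx by (auto simp: R)
  qed
  have intersection: "\<exists>p. \<forall>x y. (x, y) \<in> R k \<longrightarrow> card {w \<in> X. (x, w) \<in> R i \<and> (w, y) \<in> R j} = p"
    if idx: "i \<le> s" "j \<le> s" "k \<le> s" for i j k
  proof -
    \<comment> \<open>Take z = x: the index 0 forces z and x to be equal, and the third condition repeats the first.\<close>
    obtain p where p: "\<forall>x\<in>X. \<forall>y\<in>X. \<forall>z\<in>X. (x, y) \<in> R k \<longrightarrow> (y, z) \<in> R k \<longrightarrow> (z, x) \<in> R 0 \<longrightarrow>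
        card {w \<in> X. (w, x) \<in> R i \<and> (w, y) \<in> R j \<and> (w, z) \<in> R i} = p"
      using regular[of k k 0 i i j] idx by auto
    have "card {w \<in> X. (x, w) \<in> R i \<and> (w, y) \<in> R j} = p" if "(x, y) \<in> R k" for x y
    proof -
      have xy: "x \<in> X" "y \<in> X" "x \<bullet> y = \<alpha> k"
        using that idx by (auto simp: R)
      then have "(y, x) \<in> R k" "(x, x) \<in> R 0"
        using idx unit assms(6) by (auto simp: R inner_commute)
      then have "card {w \<in> X. (w, x) \<in> R i \<and> (w, y) \<in> R j \<and> (w, x) \<in> R i} = p"
        using p xy that by blast
      moreover have "{w \<in> X. (x, w) \<in> R i \<and> (w, y) \<in> R j}
          = {w \<in> X. (w, x) \<in> R i \<and> (w, y) \<in> R j \<and> (w, x) \<in> R i}"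
        using idx by (auto simp: R inner_commute)
      ultimately show ?thesis
        by simp
    qed
    then show ?thesis
      by blast
  qed
  have "(\<Union>k\<le>s. R k) = X \<times> X"
  proof
    show "X \<times> X \<subseteq> (\<Union>k\<le>s. R k)"
    proof clarify
      fix x y assume xy: "x \<in> X" "y \<in> X"
      have "\<exists>k\<le>s. x \<bullet> y = \<alpha> k"
      proof (cases "x = y")
        case True
        then show ?thesis
          using unit xy assms(6) by auto
      next
        case False
        then have "x \<bullet> y \<in> \<alpha> ` {1..s}"
          unfolding assms(5) using xy by blast
        then show ?thesis
          by auto
      qed
      then show "(x, y) \<in> (\<Union>k\<le>s. R k)"
        using xy by (auto simp: R)
    qed
  qed (auto simp: R)
  moreover have "disjoint_family_on R {..s}"
    unfolding disjoint_family_on_def using inj by (auto simp: R inj_on_def)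
  moreover have "R k \<noteq> {}" if "k \<le> s" for k
  proof (cases "k = 0")
    case True
    then show ?thesis
      using \<open>X \<noteq> {}\<close> unit assms(6) by (auto simp: R)
  next
    case False
    then have "\<alpha> k \<in> {x \<bullet> y | x y. x \<in> X \<and> y \<in> X \<and> x \<noteq> y}"
      unfolding assms(5)[symmetric] using that by auto
    then obtain x y where "\<alpha> k = x \<bullet> y" "x \<in> X" "y \<in> X"
      by auto
    then have "(x, y) \<in> R k"
      using that by (simp add: R)
    then show ?thesis
      by blast
  qed
  moreover have "sym (R k)" if "k \<le> s" for k
    using that by (auto simp: R sym_def inner_commute)
  moreover have "R 0 = Id_on X"
    using eq unit assms(6) by (auto simp: R)
  ultimately have "symmetric_association_scheme X s R"
    unfolding symmetric_association_scheme_def using fin intersection by blast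
  then show ?thesis
    unfolding triply_regular_association_scheme_def using regular by blast
qed

end
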